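(* Let $\phi(y)=\max\{0,y\}$ be the ReLU activation. Then $$\lambda_1=-\frac1{2d}-\frac{(\sigma_U^2+2\sigma_W^2)(d-1)}4<0$$ and $$\bar\lambda=\frac1d-\frac{(\sigma_U^2+2\sigma_W^2)(d-3)}2.$$
   Context: $d\ge2$ is an integer and $\sigma_U,\sigma_W\ge0$. For an activation $\phi:\mathbb R\to\mathbb R$, the function $\kappa:[-1,1]\to\mathbb R$ is defined by $\kappa(\langle x,y\rangle)=\mathbb E\big[\phi(\tfrac{gx}{\sqrt d}+b)\phi(\tfrac{gy}{\sqrt d}+b)\big]+\sigma_W^2$ for unit vectors $x,y\in\mathbb S^{d-1}\subset\mathbb R^d$, where $g$ is a standard Gaussian row vector in $\mathbb R^d$ and $b\sim\mathcal N(0,\sigma_U^2)$ is independent of $g$ (the right side depends only on $\langle x,y\rangle$). $\kappa'(1)$ denotes the limit of $\kappa'(t)$ as $t\to1^-$. The quantities are $$\lambda_1:=\frac{d-3}2\kappa'(1)-\frac{d-1}2\kappa(1),\qquad\bar\lambda:=(d-1)\kappa'(1)-(d-3)\kappa(1).$$ *)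

theory Defs
  imports "HOL-Probability.Probability"
begin

definition relu :: "real \<Rightarrow> real" where
  "relu y = max 0 y"

(* normal_density 0 0 is the zero function, so the degenerate law N(0, 0) is given separately. *)
definition centered_gaussian :: "real \<Rightarrow> real measure" where
  "centered_gaussian \<sigma> =
     (if \<sigma> = 0 then return borel 0 else density lborel (\<lambda>b. ennreal (normal_density 0 \<sigma> b)))"

definition std_gaussian_vec :: "(real ^ 'n::finite) measure" where
  "std_gaussian_vec = density lborel (\<lambda>g. ennreal (\<Prod>i\<in>UNIV. std_normal_density (g $ i)))"

(* Independence of g and b is expressed by the product measure. *)
definition cov_expectation ::
  "(real \<Rightarrow> real) \<Rightarrow> real \<Rightarrow> real ^ 'n::finite \<Rightarrow> real ^ 'n \<Rightarrow> real" where
  "cov_expectation \<phi> \<sigma>\<^sub>U x y =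
     (LINT (g, b) | (std_gaussian_vec \<Otimes>\<^sub>M centered_gaussian \<sigma>\<^sub>U).
        \<phi> ((g \<bullet> x) / sqrt (real CARD('n)) + b) * \<phi> ((g \<bullet> y) / sqrt (real CARD('n)) + b))"

(* The type argument carries the dimension d = CARD('n). The covariance depends on the unit
   vectors x, y only through their inner product, so for d \<ge> 2 and t in [-1, 1] the
   description has exactly one solution; values outside [-1, 1] are irrelevant. *)
definition kappa ::
  "'n::finite itself \<Rightarrow> (real \<Rightarrow> real) \<Rightarrow> real \<Rightarrow> real \<Rightarrow> real \<Rightarrow> real" where
  "kappa _ \<phi> \<sigma>\<^sub>U \<sigma>\<^sub>W t =
     (THE k. \<forall>x y :: real ^ 'n. norm x = 1 \<longrightarrow> norm y = 1 \<longrightarrow> x \<bullet> y = t \<longrightarrow>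
        k = cov_expectation \<phi> \<sigma>\<^sub>U x y + \<sigma>\<^sub>W\<^sup>2)"

definition kappa_deriv_1 ::
  "'n::finite itself \<Rightarrow> (real \<Rightarrow> real) \<Rightarrow> real \<Rightarrow> real \<Rightarrow> real" where
  "kappa_deriv_1 T \<phi> \<sigma>\<^sub>U \<sigma>\<^sub>W = Lim (at_left 1) (deriv (kappa T \<phi> \<sigma>\<^sub>U \<sigma>\<^sub>W))"

definition lambda_1 ::
  "'n::finite itself \<Rightarrow> (real \<Rightarrow> real) \<Rightarrow> real \<Rightarrow> real \<Rightarrow> real" where
  "lambda_1 T \<phi> \<sigma>\<^sub>U \<sigma>\<^sub>W =
     (real CARD('n) - 3) / 2 * kappa_deriv_1 T \<phi> \<sigma>\<^sub>U \<sigma>\<^sub>W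
     - (real CARD('n) - 1) / 2 * kappa T \<phi> \<sigma>\<^sub>U \<sigma>\<^sub>W 1"

definition lambda_bar ::
  "'n::finite itself \<Rightarrow> (real \<Rightarrow> real) \<Rightarrow> real \<Rightarrow> real \<Rightarrow> real" where
  "lambda_bar T \<phi> \<sigma>\<^sub>U \<sigma>\<^sub>W =
     (real CARD('n) - 1) * kappa_deriv_1 T \<phi> \<sigma>\<^sub>U \<sigma>\<^sub>W
     - (real CARD('n) - 3) * kappa T \<phi> \<sigma>\<^sub>U \<sigma>\<^sub>W 1"

end

theory Submission
  imports Defs "HOL-Real_Asymp.Real_Asymp"
begin

text \<open>
  For unit vectors with \<open>x \<bullet> y = t\<close>, the vectors \<open>x + y\<close> and \<open>x - y\<close> are orthogonal, so by rotation
  invariance the two preactivations are \<open>U + V\<close> and \<open>U - V\<close> with independent centred Gaussians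
  \<open>U\<close>, \<open>V\<close> of variances \<open>\<alpha>\<^sup>2 = (1 + t) / 2d + \<sigma>\<^sub>U\<^sup>2\<close> and \<open>\<beta>\<^sup>2 = (1 - t) / 2d\<close>. The integral of
  \<open>relu (U + V) * relu (U - V)\<close> becomes elementary in the coordinates \<open>u\<close>, \<open>w = v / u\<close> and equals
  \<open>((\<alpha>\<^sup>2 - \<beta>\<^sup>2) arctan (\<alpha> / \<beta>) + \<alpha> \<beta>) / \<pi>\<close>. In the derivative with respect to \<open>t\<close> all terms cancel
  except \<open>arctan (\<alpha> / \<beta>) / (\<pi> d)\<close>, which tends to \<open>1 / 2d\<close> as \<open>t \<rightarrow> 1\<close>.
\<close>

section \<open>Rotations of the standard Gaussian\<close>

text \<open>The Householder reflection in the hyperplane orthogonal to \<open>a - b\<close> swaps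
  two vectors of equal norm. The third clause says that this hyperplane is fixed pointwise, so that
  a second reflection can be applied without destroying what a first one achieved.\<close>

lemma reflection_exists:
  fixes a b :: "'a::euclidean_space"
  assumes "norm a = norm b"
  obtains f where "orthogonal_transformation f" "f a = b" "\<And>v. v \<bullet> a = v \<bullet> b \<Longrightarrow> f v = v"
proof
  define w where "w = a - b"
  \<comment> \<open>For \<open>a = b\<close> the quotient is a division by zero, hence 0, and
    \<open>f\<close> is the identity, as it should be.\<close>
  define f where "f v = v - (2 * (w \<bullet> v) / (w \<bullet> w)) *\<^sub>R w" for v
  have "linear f"
    by (rule linearI) (auto simp: f_def inner_add_right add_divide_distrib algebra_simps)
  moreover have "f u \<bullet> f v = u \<bullet> v" for u v
    by (cases "w = 0") (simp_all add: f_def inner_diff_left inner_diff_right inner_commute field_simps)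
  ultimately show "orthogonal_transformation f"
    by (simp add: orthogonal_transformation_def)
  \<comment> \<open>Equality of norms enters here: the coefficient of \<open>w\<close> in
    \<open>f a\<close> becomes 1, so \<open>f a = a - w = b\<close>.\<close>
  have "w \<bullet> w = 2 * (w \<bullet> a)"
    using assms by (simp add: w_def norm_eq inner_diff_left inner_diff_right inner_commute)
  then show "f a = b"
    by (cases "w = 0") (auto simp: f_def w_def)
  show "f v = v" if "v \<bullet> a = v \<bullet> b" for v
    using that by (simp add: f_def w_def inner_diff_left inner_diff_right inner_commute)
qed

text \<open>Two reflections suffice. The first moves \<open>a\<close> to \<open>p\<close>; the
  second moves the image of \<open>b\<close> to \<open>q\<close> and fixes \<open>p\<close>, because
  \<open>p\<close> is orthogonal to both of these vectors.\<close>

lemma orthonormal_pair_transformation: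
  fixes a b p q :: "'a::euclidean_space"
  assumes "norm a = 1" "norm b = 1" "a \<bullet> b = 0" "norm p = 1" "norm q = 1" "p \<bullet> q = 0"
  obtains f where "orthogonal_transformation f" "f a = p" "f b = q"
proof -
  obtain f where f: "orthogonal_transformation f" "f a = p"
    using reflection_exists[of a p] assms by auto
  have fb: "norm (f b) = norm q" "p \<bullet> f b = p \<bullet> q"
    using f assms by (auto simp: orthogonal_transformation_norm orthogonal_transformation_def)
  obtain h where h: "orthogonal_transformation h" "h (f b) = q" "h p = p"
    using reflection_exists[OF fb(1)] fb(2) by metis
  show ?thesis
    by (rule that[of "h \<circ> f"]) (use f h in \<open>auto intro: orthogonal_transformation_compose\<close>)
qed

section \<open>Invariance of Lebesgue integrals under isometries\<close>

lemma nn_integral_lborel_translate: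
  fixes f :: "'a::euclidean_space \<Rightarrow> ennreal"
  assumes [measurable]: "f \<in> borel_measurable borel"
  shows "(\<integral>\<^sup>+x. f (a + x) \<partial>lborel) = (\<integral>\<^sup>+x. f x \<partial>lborel)"
  by (subst (2) lborel_distr_plus[of a, symmetric]) (simp add: nn_integral_distr)

lemma nn_integral_lborel_reflect:
  fixes f :: "'a::euclidean_space \<Rightarrow> ennreal"
  assumes [measurable]: "f \<in> borel_measurable borel"
  shows "(\<integral>\<^sup>+x. f (- x) \<partial>lborel) = (\<integral>\<^sup>+x. f x \<partial>lborel)"
  by (subst (2) lborel_affine[of "-1" 0]) (simp_all add: nn_integral_distr density_1 one_ennreal_def[symmetric])

text \<open>
  Unlike \<open>measure_orthogonal_image\<close>, this does not need a well-ordered index type. The argument is the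
  uniqueness of Haar measure: the image of Lebesgue measure is translation invariant, so Fubini makes it a multiple of Lebesgue
  measure, and the invariant unit ball fixes the factor.
\<close>

lemma nn_integral_lborel_orthogonal:
  fixes T :: "'a::euclidean_space \<Rightarrow> 'a" and f :: "'a \<Rightarrow> ennreal"
  assumes T: "orthogonal_transformation T" and [measurable]: "f \<in> borel_measurable borel"
  shows "(\<integral>\<^sup>+x. f (T x) \<partial>lborel) = (\<integral>\<^sup>+x. f x \<partial>lborel)"
proof -
  have lin: "linear T" and nT: "\<And>x. norm (T x) = norm x"
    using T by (auto simp: orthogonal_transformation)
  obtain S where S: "\<And>x. T (S x) = x"
    using orthogonal_transformation_surj[OF T] by (metis surjD)
  have [measurable]: "T \<in> borel_measurable borel"
    using lin by (intro borel_measurable_continuous_onI linear_continuous_on)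
      (simp add: linear_conv_bounded_linear)
  \<comment> \<open>The test function has a finite nonzero integral, so it can be cancelled at the
    end, and it does not notice \<open>T\<close>.\<close>
  define g :: "'a \<Rightarrow> ennreal" where "g = indicator (ball 0 1)"
  have [measurable]: "g \<in> borel_measurable borel"
    unfolding g_def by (intro borel_measurable_indicator) simp
  have gT: "g (T x) = g x" for x
    by (simp add: g_def nT indicator_def)
  \<comment> \<open>\<open>T x - y\<close> equals \<open>T (x - S y)\<close>, so a translation of
    the image is a translation of the argument.\<close>
  have shift: "(\<integral>\<^sup>+x. h (T x - y) \<partial>lborel) = (\<integral>\<^sup>+x. h (T x) \<partial>lborel)"
    if [measurable]: "h \<in> borel_measurable borel" for h :: "'a \<Rightarrow> ennreal" and y
    using nn_integral_lborel_translate[of "\<lambda>x. h (T x)" "- S y"]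
    by (simp add: linear_diff[OF lin] S)
  let ?c = "\<integral>\<^sup>+y. g y \<partial>lborel"
  have "(\<integral>\<^sup>+x. f (T x) \<partial>lborel) * ?c = (\<integral>\<^sup>+x. f (T x) * (\<integral>\<^sup>+y. g y \<partial>lborel) \<partial>lborel)"
    by (simp add: nn_integral_multc)
  also have "\<dots> = (\<integral>\<^sup>+x. (\<integral>\<^sup>+y. f (T x) * g (T x + y) \<partial>lborel) \<partial>lborel)"
    by (simp add: nn_integral_cmult nn_integral_lborel_translate)
  also have "\<dots> = (\<integral>\<^sup>+y. (\<integral>\<^sup>+x. f (T x) * g (T x + y) \<partial>lborel) \<partial>lborel)"
    by (rule lborel_pair.Fubini') measurable
  \<comment> \<open>For each fixed \<open>y\<close> the shift moves \<open>y\<close> from the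
    argument of \<open>g\<close> to that of \<open>f\<close>. After the next exchange of integrals,
    \<open>f\<close> is integrated over all translates, where \<open>T x\<close> no longer
    matters.\<close>
  also have "\<dots> = (\<integral>\<^sup>+y. (\<integral>\<^sup>+x. f (T x - y) * g (T x) \<partial>lborel) \<partial>lborel)"
  proof (rule nn_integral_cong)
    fix y :: 'a
    show "(\<integral>\<^sup>+x. f (T x) * g (T x + y) \<partial>lborel) = (\<integral>\<^sup>+x. f (T x - y) * g (T x) \<partial>lborel)"
      using shift[of "\<lambda>z. f z * g (z + y)" y] by simp
  qed
  also have "\<dots> = (\<integral>\<^sup>+x. (\<integral>\<^sup>+y. f (T x - y) * g (T x) \<partial>lborel) \<partial>lborel)"
    by (rule lborel_pair.Fubini') measurable
  also have "\<dots> = (\<integral>\<^sup>+x. (\<integral>\<^sup>+y. f (T x + y) \<partial>lborel) * g x \<partial>lborel)"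
    by (simp add: nn_integral_multc gT nn_integral_lborel_reflect[where f="\<lambda>y. f (T _ - y)", symmetric])
  also have "\<dots> = (\<integral>\<^sup>+x. f x \<partial>lborel) * ?c"
    by (simp add: nn_integral_lborel_translate nn_integral_cmult)
  finally have "(\<integral>\<^sup>+x. f (T x) \<partial>lborel) * ?c = (\<integral>\<^sup>+x. f x \<partial>lborel) * ?c" .
  moreover have "?c = emeasure lborel (ball (0::'a) 1)"
    by (simp add: g_def)
  moreover have "emeasure lborel (ball (0::'a) 1) \<noteq> 0"
    using open_not_negligible[of "ball (0::'a) 1"] by (auto simp: negligible_iff_emeasure0)
  moreover have "emeasure lborel (ball (0::'a) 1) \<noteq> \<top>"
    using emeasure_lborel_ball_finite[of "0::'a" 1] by simp
  ultimately show ?thesis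
    by (metis ennreal_mult_cancel_left mult.commute)
qed

section \<open>The standard Gaussian vector in orthonormal coordinates\<close>

lemma sets_std_gaussian_vec [measurable_cong]: "sets std_gaussian_vec = sets borel"
  by (simp add: std_gaussian_vec_def)

lemma sets_centered_gaussian [measurable_cong]: "sets (centered_gaussian \<sigma>) = sets borel"
  by (simp add: centered_gaussian_def)

lemma prob_space_centered_gaussian: "0 \<le> \<sigma> \<Longrightarrow> prob_space (centered_gaussian \<sigma>)"
  by (auto simp: centered_gaussian_def intro: prob_space_return prob_space_normal_density)

text \<open>In this form the density visibly depends on the norm alone, which gives its invariance
  under orthogonal transformations.\<close>

lemma std_gaussian_vec_density:
  fixes g :: "real ^ 'n::finite"
  shows "(\<Prod>i\<in>UNIV. std_normal_density (g $ i)) = (1 / sqrt (2 * pi)) ^ CARD('n) * exp (- (norm g)\<^sup>2 / 2)"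
proof -
  have "(norm g)\<^sup>2 = (\<Sum>i\<in>UNIV. (g $ i)\<^sup>2)"
    unfolding power2_norm_eq_inner inner_vec_def by (simp add: power2_eq_square)
  then show ?thesis
    by (simp add: std_normal_density_def prod_dividef exp_sum power_divide sum_divide_distrib
        sum_negf[symmetric])
qed

lemma distr_std_gaussian_vec_orthogonal:
  fixes T :: "real ^ 'n::finite \<Rightarrow> real ^ 'n"
  assumes T: "orthogonal_transformation T"
  shows "distr std_gaussian_vec borel T = std_gaussian_vec"
proof (rule measure_eqI)
  have T_meas [measurable]: "T \<in> borel_measurable borel"
    using T by (intro borel_measurable_continuous_onI linear_continuous_on)
      (simp add: linear_conv_bounded_linear[symmetric] orthogonal_transformation)
  fix A assume "A \<in> sets (distr std_gaussian_vec borel T)"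
  then have [measurable]: "A \<in> sets borel" by simp
  let ?\<phi> = "\<lambda>g::real^'n. ennreal (\<Prod>i\<in>UNIV. std_normal_density (g $ i))"
  have inv: "?\<phi> (T g) = ?\<phi> g" for g
    using T by (simp add: std_gaussian_vec_density orthogonal_transformation_norm)
  have "emeasure (distr std_gaussian_vec borel T) A = (\<integral>\<^sup>+g. ?\<phi> g * indicator A (T g) \<partial>lborel)"
    by (simp add: emeasure_distr std_gaussian_vec_def emeasure_density measurable_sets_borel[OF T_meas] indicator_vimage)
  also have "\<dots> = (\<integral>\<^sup>+g. ?\<phi> g * indicator A g \<partial>lborel)"
    using nn_integral_lborel_orthogonal[OF T, of "\<lambda>g. ?\<phi> g * indicator A g"] by (simp add: inv)
  also have "\<dots> = emeasure std_gaussian_vec A"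
    by (simp add: std_gaussian_vec_def emeasure_density)
  finally show "emeasure (distr std_gaussian_vec borel T) A = emeasure std_gaussian_vec A" .
qed (simp add: sets_std_gaussian_vec)

text \<open>The product formula over \<open>Basis\<close>, reindexed along the bijection that sends
  \<open>k\<close> to \<open>axis k 1\<close>.\<close>

lemma nn_integral_lborel_prod_cart:
  fixes f :: "'n::finite \<Rightarrow> real \<Rightarrow> ennreal"
  assumes "\<And>k. f k \<in> borel_measurable borel"
  shows "(\<integral>\<^sup>+x. (\<Prod>k\<in>UNIV. f k (x $ k)) \<partial>lborel) = (\<Prod>k\<in>UNIV. (\<integral>\<^sup>+z. f k z \<partial>lborel))"
proof -
  have basis: "(\<Prod>b\<in>Basis. h b) = (\<Prod>k\<in>UNIV. h (axis k 1))" for h :: "real ^ 'n \<Rightarrow> ennreal"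
  proof -
    have "Basis = range (\<lambda>k::'n. axis k (1::real))"
      by (auto simp: Basis_vec_def)
    moreover have "inj (\<lambda>k::'n. axis k (1::real))"
      by (auto simp: inj_on_def axis_eq_axis)
    ultimately show ?thesis
      unfolding \<open>Basis = _\<close> by (simp add: prod.reindex)
  qed
  have "(\<integral>\<^sup>+x. (\<Prod>b\<in>(Basis::(real^'n) set). f (axis_index b) (x \<bullet> b)) \<partial>lborel) =
      (\<Prod>b\<in>(Basis::(real^'n) set). (\<integral>\<^sup>+z. f (axis_index b) z \<partial>lborel))"
    by (rule nn_integral_lborel_prod) (use assms in auto)
  then show ?thesis
    by (simp add: basis inner_axis)
qed

lemma nn_integral_std_normal_density: "(\<integral>\<^sup>+z. ennreal (std_normal_density z) \<partial>lborel) = 1"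
  using prob_space.emeasure_space_1[OF prob_space_normal_density[of 1 0]]
  by (simp add: emeasure_density)

text \<open>It is enough to compare rectangles \<open>A \<times> B\<close>. There the integral
  factors over the coordinates, and each coordinate other than \<open>i\<close> and \<open>j\<close>
  contributes the total mass 1.\<close>

lemma distr_std_gaussian_vec_coordinates:
  fixes i j :: "'n::finite"
  assumes "i \<noteq> j"
  shows "distr std_gaussian_vec (borel \<Otimes>\<^sub>M borel) (\<lambda>g. (g $ i, g $ j)) =
    centered_gaussian 1 \<Otimes>\<^sub>M centered_gaussian 1"
proof (rule pair_measure_eqI[symmetric])
  interpret N: prob_space "centered_gaussian 1"
    by (rule prob_space_centered_gaussian) simp
  show "sigma_finite_measure (centered_gaussian 1)" "sigma_finite_measure (centered_gaussian 1)"
    by (rule N.sigma_finite_measure)+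
  show "sets (centered_gaussian 1 \<Otimes>\<^sub>M centered_gaussian 1) =
      sets (distr std_gaussian_vec (borel \<Otimes>\<^sub>M borel) (\<lambda>g. (g $ i, g $ j)))"
    by (simp add: sets_centered_gaussian cong: sets_pair_measure_cong)
  fix A B :: "real set"
  assume "A \<in> sets (centered_gaussian 1)" "B \<in> sets (centered_gaussian 1)"
  then have [measurable]: "A \<in> sets borel" "B \<in> sets borel"
    by (simp_all add: sets_centered_gaussian)
  \<comment> \<open>The indicator of the rectangle is distributed over the coordinates
    \<open>i\<close> and \<open>j\<close>, so that the whole integrand is one product over all
    indices.\<close>
  define f where "f k z = ennreal (std_normal_density z) * ((if k = i then indicator A z else 1) * (if k = j then indicator B z else 1))"
    for k and z :: real
  have f_int: "(\<integral>\<^sup>+z. f k z \<partial>lborel) =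
    (if k = i then emeasure (centered_gaussian 1) A else 1) * (if k = j then emeasure (centered_gaussian 1) B else 1)" for k
    using assms by (auto simp: f_def centered_gaussian_def emeasure_density nn_integral_std_normal_density)
  have "emeasure (distr std_gaussian_vec (borel \<Otimes>\<^sub>M borel) (\<lambda>g. (g $ i, g $ j))) (A \<times> B) =
      (\<integral>\<^sup>+g. ennreal (\<Prod>k\<in>UNIV. std_normal_density (g $ k)) * indicator (A \<times> B) (g $ i, g $ j) \<partial>lborel)"
  proof -
    have "A \<times> B \<in> sets (borel \<Otimes>\<^sub>M borel)"
      by measurable
    then have "emeasure (distr std_gaussian_vec (borel \<Otimes>\<^sub>M borel) (\<lambda>g. (g $ i, g $ j))) (A \<times> B) =
        (\<integral>\<^sup>+z. indicator (A \<times> B) z \<partial>distr std_gaussian_vec (borel \<Otimes>\<^sub>M borel) (\<lambda>g. (g $ i, g $ j)))"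
      by (intro nn_integral_indicator[symmetric]) simp
    also have "\<dots> = (\<integral>\<^sup>+g. indicator (A \<times> B) (g $ i, g $ j) \<partial>std_gaussian_vec)"
      by (rule nn_integral_distr) measurable
    finally show ?thesis
      by (simp add: std_gaussian_vec_def nn_integral_density)
  qed
  also have "\<dots> = (\<integral>\<^sup>+g. (\<Prod>k\<in>UNIV. f k (g $ k)) \<partial>lborel)"
    by (rule nn_integral_cong)
      (simp add: f_def prod.distrib prod_ennreal indicator_times)
  also have "\<dots> = (\<Prod>k\<in>UNIV. (\<integral>\<^sup>+z. f k z \<partial>lborel))"
    by (rule nn_integral_lborel_prod_cart) (unfold f_def, measurable)
  also have "\<dots> = emeasure (centered_gaussian 1) A * emeasure (centered_gaussian 1) B"
    by (simp add: f_int prod.distrib)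
  finally show "emeasure (centered_gaussian 1) A * emeasure (centered_gaussian 1) B =
    emeasure (distr std_gaussian_vec (borel \<Otimes>\<^sub>M borel) (\<lambda>g. (g $ i, g $ j))) (A \<times> B)" ..
qed

text \<open>A rotation carries two coordinate axes to \<open>p\<close> and \<open>q\<close> and
  preserves the Gaussian law, which reduces the claim to two coordinates.\<close>

lemma distr_std_gaussian_vec_orthonormal:
  fixes p q :: "real ^ 'n::finite"
  assumes "norm p = 1" "norm q = 1" "p \<bullet> q = 0"
  shows "distr std_gaussian_vec (borel \<Otimes>\<^sub>M borel) (\<lambda>g. (g \<bullet> p, g \<bullet> q)) =
    centered_gaussian 1 \<Otimes>\<^sub>M centered_gaussian 1"
proof -
  \<comment> \<open>With a single index, \<open>p\<close> and \<open>q\<close> would be numbers of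
    modulus 1 whose product is 0.\<close>
  have "\<exists>i j :: 'n. i \<noteq> j"
  proof (rule ccontr)
    assume "\<not> ?thesis"
    then obtain i :: 'n where i: "(UNIV :: 'n set) = {i}"
      by blast
    have "p $ i * q $ i = 0" "\<bar>p $ i\<bar> = 1" "\<bar>q $ i\<bar> = 1"
      using assms unfolding inner_vec_def norm_vec_def L2_set_def i by simp_all
    then show False by auto
  qed
  then obtain i j :: 'n where "i \<noteq> j" by blast
  then have "norm (axis i 1 :: real^'n) = 1" "norm (axis j 1 :: real^'n) = 1" "(axis i 1 :: real^'n) \<bullet> axis j 1 = 0"
    by (simp_all add: inner_axis_axis)
  then obtain T :: "real^'n \<Rightarrow> real^'n" where T: "orthogonal_transformation T" "T (axis i 1) = p" "T (axis j 1) = q"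
    using orthonormal_pair_transformation assms by metis
  have [measurable]: "T \<in> borel_measurable borel"
    using T(1) by (intro borel_measurable_continuous_onI linear_continuous_on)
      (simp add: linear_conv_bounded_linear[symmetric] orthogonal_transformation)
  have coord: "T g \<bullet> p = g $ i" "T g \<bullet> q = g $ j" for g
    using T by (metis orthogonal_transformation_def cart_eq_inner_axis)+
  have "distr (distr std_gaussian_vec borel T) (borel \<Otimes>\<^sub>M borel) (\<lambda>g. (g \<bullet> p, g \<bullet> q)) =
      distr std_gaussian_vec (borel \<Otimes>\<^sub>M borel) (\<lambda>g. (g $ i, g $ j))"
    by (subst distr_distr) (auto simp: comp_def coord)
  then show ?thesis
    by (simp add: distr_std_gaussian_vec_orthogonal[OF T(1)] distr_std_gaussian_vec_coordinates[OF \<open>i \<noteq> j\<close>])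
qed

section \<open>Centred Gaussians on the line\<close>

lemma distr_centered_gaussian_scale:
  assumes "0 \<le> a" "0 \<le> \<sigma>"
  shows "distr (centered_gaussian \<sigma>) borel (\<lambda>x. a * x) = centered_gaussian (a * \<sigma>)"
proof -
  interpret prob_space "centered_gaussian \<sigma>"
    by (rule prob_space_centered_gaussian) fact
  consider "\<sigma> = 0" | "a = 0" | "0 < a" "0 < \<sigma>" using assms by fastforce
  then show ?thesis
  proof cases
    case 1
    then show ?thesis by (simp add: centered_gaussian_def distr_return)
  next
    case 2
    then show ?thesis
      using distr_const[of 0 borel] by (simp add: centered_gaussian_def)
  next
    case 3
    have "distributed (centered_gaussian \<sigma>) lborel (\<lambda>x. x) (normal_density 0 \<sigma>)"
      using 3 by (auto simp: distributed_def centered_gaussian_def intro!: distr_id2)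
    from normal_density_affine[OF this, of a 0] 3 show ?thesis
      by (simp add: distributed_def centered_gaussian_def cong: distr_cong)
  qed
qed

text \<open>Variances of independent Gaussians add. Standard deviation 0 has to be covered, since
  the bias may be degenerate.\<close>

lemma convolution_centered_gaussian:
  assumes "0 \<le> a" "0 \<le> b"
  shows "centered_gaussian a \<star> centered_gaussian b = centered_gaussian (sqrt (a\<^sup>2 + b\<^sup>2))"
proof -
  interpret A: prob_space "centered_gaussian a"
    by (rule prob_space_centered_gaussian) fact
  interpret B: prob_space "centered_gaussian b"
    by (rule prob_space_centered_gaussian) fact
  show ?thesis
  \<comment> \<open>A point mass at 0 has no density but is neutral for convolution, which is
    checked by integrating test functions.\<close>
  proof (cases "a = 0 \<or> b = 0")
    case True
    have "(\<integral>\<^sup>+x. f x \<partial>(centered_gaussian a \<star> centered_gaussian b)) = (\<integral>\<^sup>+x. f x \<partial>centered_gaussian (sqrt (a\<^sup>2 + b\<^sup>2)))"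
      if [measurable]: "f \<in> borel_measurable borel" for f :: "real \<Rightarrow> ennreal"
    proof -
      have "(\<integral>\<^sup>+x. f x \<partial>(centered_gaussian a \<star> centered_gaussian b)) =
          (\<integral>\<^sup>+x. \<integral>\<^sup>+y. f (x + y) \<partial>centered_gaussian b \<partial>centered_gaussian a)"
        by (rule nn_integral_convolution)
          (simp_all add: A.finite_measure_axioms B.finite_measure_axioms sets_centered_gaussian)
      also have "\<dots> = (\<integral>\<^sup>+x. f x \<partial>centered_gaussian (sqrt (a\<^sup>2 + b\<^sup>2)))"
      proof (cases "b = 0")
        case True
        have "(\<integral>\<^sup>+y. f (x + y) \<partial>centered_gaussian b) = f x" for x
          using True by (simp add: centered_gaussian_def nn_integral_return)
        then show ?thesis using True assms by simp
      next
        case False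
        then have "a = 0" using \<open>a = 0 \<or> b = 0\<close> by simp
        then have "(\<integral>\<^sup>+x. \<integral>\<^sup>+y. f (x + y) \<partial>centered_gaussian b \<partial>centered_gaussian a) =
            (\<integral>\<^sup>+y. f (0 + y) \<partial>centered_gaussian b)"
          unfolding centered_gaussian_def[of a] by (simp only: simp_thms if_True) (rule nn_integral_return, simp_all)
        then show ?thesis using \<open>a = 0\<close> assms by simp
      qed
      finally show ?thesis .
    qed
    from this[OF borel_measurable_indicator] show ?thesis
      by (intro measure_eqI) (simp_all add: sets_centered_gaussian)
  next
    case False
    then have "0 < a" "0 < b" using assms by auto
    then show ?thesis
      using A.finite_measure_axioms B.finite_measure_axioms
      by (simp add: centered_gaussian_def convolution_density ennreal_mult'[symmetric] conv_normal_density_zero_mean sum_power2_eq_zero_iff)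
  qed
qed

text \<open>This will be the integral over \<open>u\<close> in the coordinates \<open>u\<close>,
  \<open>w = v / u\<close>. The antiderivative \<open>F\<close> vanishes at infinity, so the value
  is \<open>- F 0\<close>.\<close>

lemma nn_integral_cube_gaussian:
  fixes k :: real
  assumes "0 < k"
  shows "(\<integral>\<^sup>+x. ennreal (x ^ 3 * exp (- (k * x\<^sup>2))) * indicator {0..} x \<partial>lborel) = ennreal (1 / (2 * k\<^sup>2))"
proof -
  define c where "c = - 1 / (2 * k\<^sup>2)"
  define F where "F x = c * ((k * x\<^sup>2 + 1) * exp (- (k * x\<^sup>2)))" for x
  have "(F has_real_derivative x ^ 3 * exp (- (k * x\<^sup>2))) (at x)" for x
  proof -
    have "(F has_real_derivative
        c * (k * (2 * x) * exp (- (k * x\<^sup>2)) + (k * x\<^sup>2 + 1) * (exp (- (k * x\<^sup>2)) * (- (k * (2 * x)))))) (at x)"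
      unfolding F_def by (auto intro!: derivative_eq_intros)
    also have "c * (k * (2 * x) * exp (- (k * x\<^sup>2)) + (k * x\<^sup>2 + 1) * (exp (- (k * x\<^sup>2)) * (- (k * (2 * x))))) =
        x ^ 3 * exp (- (k * x\<^sup>2))"
      using assms by (simp add: c_def field_simps power2_eq_square power3_eq_cube)
    finally show ?thesis .
  qed
  moreover have "(F \<longlongrightarrow> 0) at_top"
    unfolding F_def using assms by real_asymp
  ultimately show ?thesis
    using nn_integral_FTC_atLeast[of "\<lambda>x. x ^ 3 * exp (- (k * x\<^sup>2))" 0 F 0] by (simp add: F_def c_def)
qed

lemma sigma_finite_centered_gaussian: "0 \<le> \<sigma> \<Longrightarrow> sigma_finite_measure (centered_gaussian \<sigma>)"
  using prob_space_centered_gaussian prob_space_imp_sigma_finite by blast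

text \<open>The iterated integral is a convolution in disguise; this is how the bias gets absorbed
  into one Gaussian variable.\<close>

lemma nn_integral_centered_gaussian_sum:
  fixes f :: "real \<Rightarrow> ennreal"
  assumes "0 \<le> a" "0 \<le> \<sigma>" and [measurable]: "f \<in> borel_measurable borel"
  shows "(\<integral>\<^sup>+x. \<integral>\<^sup>+y. f (a * x + y) \<partial>centered_gaussian \<sigma> \<partial>centered_gaussian 1) =
    (\<integral>\<^sup>+z. f z \<partial>centered_gaussian (sqrt (a\<^sup>2 + \<sigma>\<^sup>2)))"
proof -
  interpret sigma_finite_measure "centered_gaussian \<sigma>"
    by (rule sigma_finite_centered_gaussian) fact
  have "(\<integral>\<^sup>+x. \<integral>\<^sup>+y. f (a * x + y) \<partial>centered_gaussian \<sigma> \<partial>centered_gaussian 1) =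
      (\<integral>\<^sup>+x. \<integral>\<^sup>+y. f (x + y) \<partial>centered_gaussian \<sigma> \<partial>distr (centered_gaussian 1) borel (\<lambda>x. a * x))"
    by (subst nn_integral_distr) auto
  also have "\<dots> = (\<integral>\<^sup>+x. \<integral>\<^sup>+y. f (x + y) \<partial>centered_gaussian \<sigma> \<partial>centered_gaussian a)"
    using assms by (simp add: distr_centered_gaussian_scale)
  also have "\<dots> = (\<integral>\<^sup>+z. f z \<partial>(centered_gaussian a \<star> centered_gaussian \<sigma>))"
    using assms by (intro nn_integral_convolution[symmetric])
      (auto simp: sets_centered_gaussian intro: prob_space.finite_measure prob_space_centered_gaussian)
  finally show ?thesis
    using assms by (simp add: convolution_centered_gaussian)
qed

text \<open>\<open>g \<bullet> p\<close>, \<open>g \<bullet> q\<close> and the bias are independent.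
  The bias only enters the first component, so it adds its variance there and leaves the components
  independent.\<close>

lemma nn_integral_std_gaussian_vec_shift:
  fixes p q :: "real ^ 'n::finite" and k :: "real \<times> real \<Rightarrow> ennreal"
  assumes pq: "norm p = 1" "norm q = 1" "p \<bullet> q = 0"
    and nn: "0 \<le> a" "0 \<le> c" "0 \<le> \<sigma>"
    and [measurable]: "k \<in> borel_measurable (borel \<Otimes>\<^sub>M borel)"
  shows "(\<integral>\<^sup>+z. k (a * (fst z \<bullet> p) + snd z, c * (fst z \<bullet> q)) \<partial>(std_gaussian_vec \<Otimes>\<^sub>M centered_gaussian \<sigma>)) =
    (\<integral>\<^sup>+u. \<integral>\<^sup>+v. k (u, v) \<partial>centered_gaussian c \<partial>centered_gaussian (sqrt (a\<^sup>2 + \<sigma>\<^sup>2)))"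
proof -
  interpret S: sigma_finite_measure "centered_gaussian \<sigma>"
    by (rule sigma_finite_centered_gaussian) fact
  interpret C: sigma_finite_measure "centered_gaussian c"
    by (rule sigma_finite_centered_gaussian) fact
  interpret N: sigma_finite_measure "centered_gaussian 1"
    by (rule sigma_finite_centered_gaussian) simp
  interpret NS: pair_sigma_finite "centered_gaussian 1" "centered_gaussian \<sigma>" ..
  define G where "G w = (\<integral>\<^sup>+b. k (a * fst w + b, c * snd w) \<partial>centered_gaussian \<sigma>)" for w :: "real \<times> real"
  have [measurable]: "G \<in> borel_measurable (borel \<Otimes>\<^sub>M borel)"
    unfolding G_def by measurable
  have "(\<integral>\<^sup>+z. k (a * (fst z \<bullet> p) + snd z, c * (fst z \<bullet> q)) \<partial>(std_gaussian_vec \<Otimes>\<^sub>M centered_gaussian \<sigma>)) =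
      (\<integral>\<^sup>+g. G (g \<bullet> p, g \<bullet> q) \<partial>std_gaussian_vec)"
    unfolding G_def by (subst S.nn_integral_fst[symmetric]) auto
  also have "\<dots> = (\<integral>\<^sup>+w. G w \<partial>distr std_gaussian_vec (borel \<Otimes>\<^sub>M borel) (\<lambda>g. (g \<bullet> p, g \<bullet> q)))"
    by (rule nn_integral_distr[symmetric]) auto
  also have "\<dots> = (\<integral>\<^sup>+x. \<integral>\<^sup>+y. G (x, y) \<partial>centered_gaussian 1 \<partial>centered_gaussian 1)"
    by (simp add: distr_std_gaussian_vec_orthonormal[OF pq] N.nn_integral_fst)
  \<comment> \<open>With \<open>y\<close> innermost, what remains depends on \<open>x\<close> and
    \<open>b\<close> only through \<open>a * x + b\<close>.\<close>
  also have "\<dots> = (\<integral>\<^sup>+x. \<integral>\<^sup>+b. \<integral>\<^sup>+y. k (a * x + b, c * y) \<partial>centered_gaussian 1 \<partial>centered_gaussian \<sigma> \<partial>centered_gaussian 1)"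
    unfolding G_def by (intro nn_integral_cong) (simp add: NS.Fubini')
  also have "\<dots> = (\<integral>\<^sup>+u. \<integral>\<^sup>+y. k (u, c * y) \<partial>centered_gaussian 1 \<partial>centered_gaussian (sqrt (a\<^sup>2 + \<sigma>\<^sup>2)))"
    using nn by (intro nn_integral_centered_gaussian_sum) auto
  also have "\<dots> = (\<integral>\<^sup>+u. \<integral>\<^sup>+v. k (u, v) \<partial>distr (centered_gaussian 1) borel (\<lambda>y. c * y) \<partial>centered_gaussian (sqrt (a\<^sup>2 + \<sigma>\<^sup>2)))"
    by (intro nn_integral_cong nn_integral_distr[symmetric]) auto
  finally show ?thesis
    using nn by (simp add: distr_centered_gaussian_scale)
qed

section \<open>The covariance of two rectified Gaussians\<close>

lemma relu_measurable [measurable]: "relu \<in> borel_measurable borel"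
  unfolding relu_def by measurable

lemma relu_nonneg [simp]: "0 \<le> relu x"
  by (simp add: relu_def)

text \<open>By symmetry the positive half line carries half of the second moment: the squares of
  \<open>relu u\<close> and \<open>relu (- u)\<close> add up to the square of \<open>u\<close>. This
  settles the case of equal inputs, where \<beta> is 0.\<close>

lemma nn_integral_relu_square_gaussian:
  assumes "0 < \<alpha>"
  shows "(\<integral>\<^sup>+u. ennreal (relu u * relu u) \<partial>centered_gaussian \<alpha>) = ennreal (\<alpha>\<^sup>2 / 2)"
proof -
  let ?\<phi> = "normal_density 0 \<alpha>"
  let ?I = "\<integral>\<^sup>+u. ennreal (?\<phi> u * (relu u * relu u)) \<partial>lborel"
  have refl: "(\<integral>\<^sup>+u. ennreal (?\<phi> u * (relu (- u) * relu (- u))) \<partial>lborel) = ?I"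
    using nn_integral_lborel_reflect[of "\<lambda>u::real. ennreal (?\<phi> u * (relu u * relu u))"]
    by (simp add: normal_density_def)
  have "?I + ?I = (\<integral>\<^sup>+u. ennreal (?\<phi> u * (relu u * relu u)) + ennreal (?\<phi> u * (relu (- u) * relu (- u))) \<partial>lborel)"
    by (subst nn_integral_add) (simp_all add: refl)
  also have "\<dots> = (\<integral>\<^sup>+u. ennreal (?\<phi> u * u ^ (2 * 1)) \<partial>lborel)"
    by (intro nn_integral_cong)
      (auto simp: ennreal_plus[symmetric] relu_def max_def power2_eq_square simp del: ennreal_plus)
  also have "\<dots> = ennreal (\<alpha>\<^sup>2)"
    using normal_moment_even[OF assms, of 0 1]
    by (intro nn_integral_eq_integrable[THEN iffD2])
      (auto simp: has_bochner_integral_iff)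
  finally have "2 * ?I = 2 * ennreal (\<alpha>\<^sup>2 / 2)"
    by (simp add: mult_2[symmetric] ennreal_numeral[symmetric] ennreal_mult'[symmetric] del: ennreal_numeral)
  then have "?I = ennreal (\<alpha>\<^sup>2 / 2)"
    by (simp add: ennreal_mult_cancel_left)
  then show ?thesis
    using assms by (simp add: centered_gaussian_def nn_integral_density ennreal_mult')
qed

text \<open>This is the integral left over once \<open>u\<close> has been integrated out; an
  explicit antiderivative evaluates it.\<close>

lemma nn_integral_arc_cosine_kernel:
  fixes \<alpha> \<beta> :: real
  assumes "0 < \<alpha>" "0 < \<beta>"
  shows "(\<integral>\<^sup>+w. ennreal ((1 - w\<^sup>2) * (\<alpha> ^ 3 * \<beta> ^ 3) / (pi * (\<beta>\<^sup>2 + \<alpha>\<^sup>2 * w\<^sup>2)\<^sup>2)) * indicator {-1..1} w \<partial>lborel) =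
    ennreal (((\<alpha>\<^sup>2 - \<beta>\<^sup>2) * arctan (\<alpha> / \<beta>) + \<alpha> * \<beta>) / pi)"
proof -
  define D where "D w = \<beta>\<^sup>2 + \<alpha>\<^sup>2 * w\<^sup>2" for w
  have D: "D w > 0" for w
    using assms by (simp add: D_def add_pos_nonneg)
  \<comment> \<open>The two summands are multiples of the primitives of \<open>1 / D w\<close> and
    of \<open>(\<beta>\<^sup>2 - \<alpha>\<^sup>2 * w\<^sup>2) / (D w)\<^sup>2\<close>. The
    coefficients are chosen so that the numerators combine to a multiple of
    \<open>1 - w\<^sup>2\<close>.\<close>
  define F where "F w = ((\<alpha>\<^sup>2 - \<beta>\<^sup>2) / 2 * arctan (\<alpha> * w / \<beta>) + (\<alpha>\<^sup>2 + \<beta>\<^sup>2) / 2 * (\<alpha> * \<beta> * w / D w)) / pi" for w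
  have dD: "(D has_real_derivative \<alpha>\<^sup>2 * (2 * w)) (at w)" for w
    unfolding D_def by (auto intro!: derivative_eq_intros)
  have datan: "((\<lambda>w. arctan (\<alpha> * w / \<beta>)) has_real_derivative \<alpha> * \<beta> / D w) (at w)" for w
  proof -
    have "((\<lambda>w. arctan (\<alpha> * w / \<beta>)) has_real_derivative inverse (1 + (\<alpha> * w / \<beta>)\<^sup>2) * (\<alpha> / \<beta>)) (at w)"
      using assms by (auto intro!: derivative_eq_intros)
    also have "inverse (1 + (\<alpha> * w / \<beta>)\<^sup>2) * (\<alpha> / \<beta>) = \<alpha> * \<beta> / D w"
      using assms D[of w] by (simp add: D_def field_simps power2_eq_square)
    finally show ?thesis .
  qed
  have "(F has_real_derivative (1 - w\<^sup>2) * (\<alpha> ^ 3 * \<beta> ^ 3) / (pi * (D w)\<^sup>2)) (at w)" for w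
  proof -
    have "(F has_real_derivative ((\<alpha>\<^sup>2 - \<beta>\<^sup>2) / 2 * (\<alpha> * \<beta> / D w) +
        (\<alpha>\<^sup>2 + \<beta>\<^sup>2) / 2 * ((\<alpha> * \<beta> * D w - \<alpha> * \<beta> * w * (\<alpha>\<^sup>2 * (2 * w))) / (D w * D w))) / pi) (at w)"
      unfolding F_def using D[of w]
      by (intro DERIV_cdivide DERIV_add DERIV_cmult datan DERIV_divide[OF DERIV_cmult_Id dD]) simp
    also have "((\<alpha>\<^sup>2 - \<beta>\<^sup>2) / 2 * (\<alpha> * \<beta> / D w) +
        (\<alpha>\<^sup>2 + \<beta>\<^sup>2) / 2 * ((\<alpha> * \<beta> * D w - \<alpha> * \<beta> * w * (\<alpha>\<^sup>2 * (2 * w))) / (D w * D w))) / pi =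
        (1 - w\<^sup>2) * (\<alpha> ^ 3 * \<beta> ^ 3) / (pi * (D w)\<^sup>2)"
    proof -
      have "(\<alpha>\<^sup>2 - \<beta>\<^sup>2) / 2 * (\<alpha> * \<beta> / D w) +
          (\<alpha>\<^sup>2 + \<beta>\<^sup>2) / 2 * ((\<alpha> * \<beta> * D w - \<alpha> * \<beta> * w * (\<alpha>\<^sup>2 * (2 * w))) / (D w * D w)) =
          ((\<alpha>\<^sup>2 - \<beta>\<^sup>2) * (\<alpha> * \<beta>) * D w +
          (\<alpha>\<^sup>2 + \<beta>\<^sup>2) * (\<alpha> * \<beta> * D w - \<alpha> * \<beta> * w * (\<alpha>\<^sup>2 * (2 * w)))) / (2 * (D w)\<^sup>2)"
        using D[of w] by (simp add: divide_simps power2_eq_square)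
      also have "(\<alpha>\<^sup>2 - \<beta>\<^sup>2) * (\<alpha> * \<beta>) * D w +
          (\<alpha>\<^sup>2 + \<beta>\<^sup>2) * (\<alpha> * \<beta> * D w - \<alpha> * \<beta> * w * (\<alpha>\<^sup>2 * (2 * w))) = 2 * ((1 - w\<^sup>2) * (\<alpha> ^ 3 * \<beta> ^ 3))"
        unfolding D_def by algebra
      finally show ?thesis
        by (simp add: mult.commute)
    qed
    finally show ?thesis .
  qed
  moreover have "0 \<le> (1 - w\<^sup>2) * (\<alpha> ^ 3 * \<beta> ^ 3) / (pi * (D w)\<^sup>2)" if "w \<in> {-1..1}" for w
    using that assms by (auto intro!: divide_nonneg_nonneg mult_nonneg_nonneg simp: abs_square_le_1)
  moreover have "F 1 - F (-1) = ((\<alpha>\<^sup>2 - \<beta>\<^sup>2) * arctan (\<alpha> / \<beta>) + \<alpha> * \<beta>) / pi"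
  proof -
    have D1: "D 1 = \<alpha>\<^sup>2 + \<beta>\<^sup>2" "D (-1) = \<alpha>\<^sup>2 + \<beta>\<^sup>2"
      by (simp_all add: D_def)
    moreover have "(\<alpha>\<^sup>2 + \<beta>\<^sup>2) / 2 * (\<alpha> * \<beta> / (\<alpha>\<^sup>2 + \<beta>\<^sup>2)) = \<alpha> * \<beta> / 2"
    proof -
      have "S / 2 * (\<alpha> * \<beta> / S) = \<alpha> * \<beta> / 2" if "S \<noteq> 0" for S
        using that by simp
      then show ?thesis
        using assms by (simp add: sum_power2_eq_zero_iff del: times_divide_eq_right times_divide_eq_left)
    qed
    ultimately have "F 1 = ((\<alpha>\<^sup>2 - \<beta>\<^sup>2) / 2 * arctan (\<alpha> / \<beta>) + \<alpha> * \<beta> / 2) / pi"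
      by (simp only: F_def D1 mult_1_right)
    \<comment> \<open>\<open>F\<close> is odd, so the integral is twice \<open>F 1\<close>.\<close>
    moreover have "F (-1) = - F 1"
      unfolding F_def D1
      by (simp add: arctan_minus add_divide_distrib diff_divide_distrib)
    ultimately show ?thesis
      by (simp add: field_simps)
  qed
  moreover have "(\<lambda>w. (1 - w\<^sup>2) * (\<alpha> ^ 3 * \<beta> ^ 3) / (pi * (D w)\<^sup>2)) \<in> borel_measurable borel"
    unfolding D_def by measurable
  ultimately show ?thesis
    using nn_integral_FTC_Icc[of "\<lambda>w. (1 - w\<^sup>2) * (\<alpha> ^ 3 * \<beta> ^ 3) / (pi * (D w)\<^sup>2)" "-1" 1 F]
    by (simp add: D_def)
qed

text \<open>For \<open>u > 0\<close> both rectifiers are active on the interval from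
  \<open>- u\<close> to \<open>u\<close> in \<open>v\<close>; the substitution
  \<open>v = u * w\<close> turns it into the fixed interval from -1 to 1. The integral over
  \<open>u\<close> can then be taken first.\<close>

lemma nn_integral_relu_gaussian:
  fixes \<alpha> \<beta> :: real
  assumes \<alpha>: "0 < \<alpha>" and \<beta>: "0 < \<beta>"
  shows "(\<integral>\<^sup>+u. \<integral>\<^sup>+v. ennreal (relu (u + v) * relu (u - v)) \<partial>centered_gaussian \<beta> \<partial>centered_gaussian \<alpha>) =
    ennreal (((\<alpha>\<^sup>2 - \<beta>\<^sup>2) * arctan (\<alpha> / \<beta>) + \<alpha> * \<beta>) / pi)"
proof -
  \<comment> \<open>The exponents of the two normal densities at \<open>u\<close> and
    \<open>u * w\<close> add up to \<open>- (k w * u\<^sup>2)\<close>.\<close>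
  define k where "k w = (\<beta>\<^sup>2 + \<alpha>\<^sup>2 * w\<^sup>2) / (2 * \<alpha>\<^sup>2 * \<beta>\<^sup>2)" for w
  have k: "k w > 0" for w
    using assms by (simp add: k_def add_pos_nonneg)
  \<comment> \<open>The integrand in the new coordinates: the rectifiers give
    \<open>u\<^sup>2 * (1 - w\<^sup>2)\<close>, and the Jacobian gives the third factor
    \<open>u\<close>.\<close>
  define G where "G u w = ennreal ((1 - w\<^sup>2) / (2 * pi * \<alpha> * \<beta>)) * indicator {-1..1} w *
    (ennreal (u ^ 3 * exp (- (k w * u\<^sup>2))) * indicator {0..} u)" for u w
  have G_meas [measurable]: "case_prod G \<in> borel_measurable (borel \<Otimes>\<^sub>M borel)"
    unfolding G_def k_def by measurable
  have inner: "ennreal (normal_density 0 \<alpha> u) *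
      (\<integral>\<^sup>+v. ennreal (normal_density 0 \<beta> v) * ennreal (relu (u + v) * relu (u - v)) \<partial>lborel) =
      (\<integral>\<^sup>+w. G u w \<partial>lborel)" for u
  proof (cases "0 < u")
    case True
    have "(\<integral>\<^sup>+v. ennreal (normal_density 0 \<beta> v) * ennreal (relu (u + v) * relu (u - v)) \<partial>lborel) =
      ennreal u * (\<integral>\<^sup>+w. ennreal (normal_density 0 \<beta> (u * w)) * ennreal (relu (u + u * w) * relu (u - u * w)) \<partial>lborel)"
      using True by (subst nn_integral_real_affine[where c=u and t=0]) auto
    then have "ennreal (normal_density 0 \<alpha> u) *
      (\<integral>\<^sup>+v. ennreal (normal_density 0 \<beta> v) * ennreal (relu (u + v) * relu (u - v)) \<partial>lborel) =
      (\<integral>\<^sup>+w. ennreal (normal_density 0 \<alpha> u) * (ennreal u *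
        (ennreal (normal_density 0 \<beta> (u * w)) * ennreal (relu (u + u * w) * relu (u - u * w)))) \<partial>lborel)"
      by (simp add: nn_integral_cmult)
    also have "\<dots> = (\<integral>\<^sup>+w. G u w \<partial>lborel)"
    proof (rule nn_integral_cong)
      fix w :: real
      have r: "relu (u + u * w) * relu (u - u * w) = u\<^sup>2 * ((1 - w\<^sup>2) * indicator {-1..1} w)"
      proof -
        have "relu (u + u * w) = u * relu (1 + w)" "relu (u - u * w) = u * relu (1 - w)"
          using True by (simp_all add: relu_def max_mult_distrib_left algebra_simps)
        then show ?thesis
          by (auto simp: relu_def max_def power2_eq_square algebra_simps indicator_def)
      qed
      have d: "normal_density 0 \<alpha> u * normal_density 0 \<beta> (u * w) = exp (- (k w * u\<^sup>2)) / (2 * pi * \<alpha> * \<beta>)"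
      proof -
        have "- u\<^sup>2 / (2 * \<alpha>\<^sup>2) + - (u * w)\<^sup>2 / (2 * \<beta>\<^sup>2) = - (k w * u\<^sup>2)"
          using assms by (simp add: k_def field_simps)
        moreover have "sqrt (2 * pi * \<alpha>\<^sup>2) * sqrt (2 * pi * \<beta>\<^sup>2) = 2 * pi * \<alpha> * \<beta>"
        proof -
          have "2 * pi * \<alpha>\<^sup>2 * (2 * pi * \<beta>\<^sup>2) = (2 * pi * \<alpha> * \<beta>)\<^sup>2"
            by (simp add: power2_eq_square)
          then show ?thesis
            using assms by (simp add: real_sqrt_mult[symmetric] del: real_sqrt_mult)
        qed
        ultimately show ?thesis
          by (simp add: normal_density_def exp_add[symmetric])
      qed
      have nn: "0 \<le> (1 - w\<^sup>2) * indicator {-1..1} w"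
        by (auto simp: indicator_def abs_square_le_1)
      have "ennreal (normal_density 0 \<alpha> u) * (ennreal u *
          (ennreal (normal_density 0 \<beta> (u * w)) * ennreal (relu (u + u * w) * relu (u - u * w)))) =
          ennreal (normal_density 0 \<alpha> u * normal_density 0 \<beta> (u * w) * (u * (relu (u + u * w) * relu (u - u * w))))"
        using True by (simp add: ennreal_mult'[symmetric] ac_simps)
      also have "\<dots> = ennreal (((1 - w\<^sup>2) / (2 * pi * \<alpha> * \<beta>) * indicator {-1..1} w) * (u ^ 3 * exp (- (k w * u\<^sup>2))))"
        unfolding r d by (simp add: power2_eq_square power3_eq_cube ac_simps)
      also have "\<dots> = G u w"
      proof -
        have "ennreal ((1 - w\<^sup>2) / (2 * pi * \<alpha> * \<beta>) * (u ^ 3 * exp (- (k w * u\<^sup>2)))) =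
            ennreal ((1 - w\<^sup>2) / (2 * pi * \<alpha> * \<beta>)) * ennreal (u ^ 3 * exp (- (k w * u\<^sup>2)))"
          by (rule ennreal_mult'') (use True in simp)
        then show ?thesis
          unfolding G_def using True by (cases "w \<in> {-1..1}") simp_all
      qed
      finally show "ennreal (normal_density 0 \<alpha> u) * (ennreal u *
          (ennreal (normal_density 0 \<beta> (u * w)) * ennreal (relu (u + u * w) * relu (u - u * w)))) = G u w" .
    qed
    finally show ?thesis .
  next
    \<comment> \<open>For \<open>u \<le> 0\<close> the numbers \<open>u + v\<close> and
      \<open>u - v\<close> have a nonpositive sum, so they are not both positive.\<close>
    case False
    then have "relu (u + v) = 0 \<or> relu (u - v) = 0" for v
      by (auto simp: relu_def max_def)
    then have "(\<lambda>v. ennreal (normal_density 0 \<beta> v) * ennreal (relu (u + v) * relu (u - v))) = (\<lambda>v. 0)"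
      by auto
    moreover have "G u w = 0" for w
      using False by (cases "u = 0") (auto simp: G_def)
    ultimately show ?thesis by simp
  qed
  interpret B: sigma_finite_measure "centered_gaussian \<beta>"
    by (rule sigma_finite_centered_gaussian) (use \<beta> in simp)
  have "(\<integral>\<^sup>+u. \<integral>\<^sup>+v. ennreal (relu (u + v) * relu (u - v)) \<partial>centered_gaussian \<beta> \<partial>centered_gaussian \<alpha>) =
      (\<integral>\<^sup>+u. ennreal (normal_density 0 \<alpha> u) *
        (\<integral>\<^sup>+v. ennreal (relu (u + v) * relu (u - v)) \<partial>centered_gaussian \<beta>) \<partial>lborel)"
    unfolding centered_gaussian_def[of \<alpha>] using \<alpha> by (simp add: nn_integral_density)
  also have "\<dots> = (\<integral>\<^sup>+u. ennreal (normal_density 0 \<alpha> u) *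
      (\<integral>\<^sup>+v. ennreal (normal_density 0 \<beta> v) * ennreal (relu (u + v) * relu (u - v)) \<partial>lborel) \<partial>lborel)"
    using \<beta> by (simp add: centered_gaussian_def nn_integral_density)
  also have "\<dots> = (\<integral>\<^sup>+u. \<integral>\<^sup>+w. G u w \<partial>lborel \<partial>lborel)"
    by (simp add: inner)
  also have "\<dots> = (\<integral>\<^sup>+w. \<integral>\<^sup>+u. G u w \<partial>lborel \<partial>lborel)"
    by (rule lborel_pair.Fubini'[symmetric]) simp
  also have "\<dots> = (\<integral>\<^sup>+w. ennreal ((1 - w\<^sup>2) * (\<alpha> ^ 3 * \<beta> ^ 3) / (pi * (\<beta>\<^sup>2 + \<alpha>\<^sup>2 * w\<^sup>2)\<^sup>2)) * indicator {-1..1} w \<partial>lborel)"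
  proof (rule nn_integral_cong)
    fix w :: real
    define D where "D = \<beta>\<^sup>2 + \<alpha>\<^sup>2 * w\<^sup>2"
    have D: "D \<noteq> 0" using assms by (simp add: D_def add_pos_nonneg less_imp_neq[symmetric])
    have "1 / (2 * (k w)\<^sup>2) = 2 * \<alpha> ^ 4 * \<beta> ^ 4 / D\<^sup>2"
      by (simp add: k_def D_def[symmetric] power_divide power_mult_distrib)
    moreover have "(1 - w\<^sup>2) / (2 * pi * \<alpha> * \<beta>) * (2 * \<alpha> ^ 4 * \<beta> ^ 4 / D\<^sup>2) =
        (1 - w\<^sup>2) * (\<alpha> ^ 3 * \<beta> ^ 3) / (pi * D\<^sup>2)"
    proof -
      have "2 * pi * \<alpha> * \<beta> * D\<^sup>2 \<noteq> 0" "pi * D\<^sup>2 \<noteq> 0"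
        using assms D by simp_all
      then show ?thesis
        unfolding times_divide_times_eq
        by (subst frac_eq_eq) (simp_all only: not_False_eq_True power4_eq_xxxx power3_eq_cube ac_simps)
    qed
    ultimately have "(1 - w\<^sup>2) / (2 * pi * \<alpha> * \<beta>) * (1 / (2 * (k w)\<^sup>2)) =
        (1 - w\<^sup>2) * (\<alpha> ^ 3 * \<beta> ^ 3) / (pi * D\<^sup>2)"
      by (simp only:)
    moreover have "(\<integral>\<^sup>+u. G u w \<partial>lborel) =
        ennreal ((1 - w\<^sup>2) / (2 * pi * \<alpha> * \<beta>)) * indicator {-1..1} w * ennreal (1 / (2 * (k w)\<^sup>2))"
      unfolding G_def by (subst nn_integral_cmult) (measurable, simp only: nn_integral_cube_gaussian[OF k])
    moreover have "\<dots> = ennreal ((1 - w\<^sup>2) / (2 * pi * \<alpha> * \<beta>) * (1 / (2 * (k w)\<^sup>2))) * indicator {-1..1} w"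
      by (subst ennreal_mult'') (simp_all add: mult.commute mult.left_commute)
    ultimately show "(\<integral>\<^sup>+u. G u w \<partial>lborel) =
        ennreal ((1 - w\<^sup>2) * (\<alpha> ^ 3 * \<beta> ^ 3) / (pi * (\<beta>\<^sup>2 + \<alpha>\<^sup>2 * w\<^sup>2)\<^sup>2)) * indicator {-1..1} w"
      by (simp only: D_def)
  qed
  finally show ?thesis
    using nn_integral_arc_cosine_kernel[OF assms] by simp
qed

section \<open>The function kappa\<close>

text \<open>Only inner products near 1 matter later, and nonnegative ones keep \<open>x + y\<close>
  away from 0 and \<alpha> positive. Equal inputs need their own value: there \<beta> is 0, and the
  arctan formula would evaluate to 0 because of the division by zero.\<close>

lemma cov_expectation_relu:
  fixes x y :: "real ^ 'n::finite"
  assumes d: "2 \<le> CARD('n)" and x: "norm x = 1" and y: "norm y = 1" and t: "0 \<le> x \<bullet> y"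
    and \<sigma>: "0 \<le> \<sigma>"
  defines "\<alpha> \<equiv> sqrt ((1 + x \<bullet> y) / (2 * real CARD('n)) + \<sigma>\<^sup>2)"
    and "\<beta> \<equiv> sqrt ((1 - x \<bullet> y) / (2 * real CARD('n)))"
  shows "cov_expectation relu \<sigma> x y =
    (if x = y then \<alpha>\<^sup>2 / 2 else ((\<alpha>\<^sup>2 - \<beta>\<^sup>2) * arctan (\<alpha> / \<beta>) + \<alpha> * \<beta>) / pi)"
proof -
  define D where "D = sqrt (real CARD('n))"
  have D: "0 < D" by (simp add: D_def)
  have sum: "(norm (x + y))\<^sup>2 = 2 * (1 + x \<bullet> y)" and diff: "(norm (x - y))\<^sup>2 = 2 * (1 - x \<bullet> y)"
    using x y by (simp_all add: power2_norm_eq_inner inner_add inner_diff norm_eq_1 inner_commute)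
  have "0 < norm (x + y)"
    using sum t by (cases "x + y = 0") auto
  define p where "p = (x + y) /\<^sub>R norm (x + y)"
  have p: "norm p = 1" "norm (x + y) *\<^sub>R p = x + y"
    using \<open>0 < norm (x + y)\<close> by (auto simp: p_def)
  have orth: "(x + y) \<bullet> (x - y) = 0"
    using x y by (simp add: inner_add inner_diff norm_eq_1 inner_commute)
  \<comment> \<open>For \<open>x = y\<close> the direction of \<open>x - y\<close> is undefined. Any
    unit vector orthogonal to \<open>p\<close> will do, as its coefficient is 0; one exists because
    the dimension is at least 2.\<close>
  obtain q where q: "norm q = 1" "p \<bullet> q = 0" "norm (x - y) *\<^sub>R q = x - y"
  proof (cases "x = y")
    case True
    obtain z where "z \<noteq> 0" "orthogonal p z"
      using orthogonal_to_vector_exists[of p] d by auto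
    then show ?thesis
      using True by (intro that[of "z /\<^sub>R norm z"]) (auto simp: orthogonal_def)
  next
    case False
    then show ?thesis
      using orth by (intro that[of "(x - y) /\<^sub>R norm (x - y)"]) (auto simp: p_def)
  qed
  define a where "a = norm (x + y) / (2 * D)"
  define c where "c = norm (x - y) / (2 * D)"
  have nn: "0 \<le> a" "0 \<le> c" using D by (auto simp: a_def c_def)
  have D2: "D\<^sup>2 = real CARD('n)" by (simp add: D_def)
  have half: "2 * r / (2 * D)\<^sup>2 = r / (2 * real CARD('n))" for r
    by (simp add: power_mult_distrib D2)
  have \<alpha>: "sqrt (a\<^sup>2 + \<sigma>\<^sup>2) = \<alpha>"
    unfolding a_def \<alpha>_def power_divide sum half ..
  have "c = sqrt (c\<^sup>2)"
    using nn by simp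
  then have \<beta>: "c = \<beta>"
    unfolding c_def \<beta>_def power_divide diff half .
  have split: "g \<bullet> x / D = a * (g \<bullet> p) + c * (g \<bullet> q)" "g \<bullet> y / D = a * (g \<bullet> p) - c * (g \<bullet> q)" for g
  proof -
    have "norm (x + y) * (g \<bullet> p) = g \<bullet> x + g \<bullet> y" "norm (x - y) * (g \<bullet> q) = g \<bullet> x - g \<bullet> y"
      using arg_cong[OF p(2), of "inner g"] arg_cong[OF q(3), of "inner g"]
      by (simp_all add: inner_add_right inner_diff_right)
    then have "a * (g \<bullet> p) = (g \<bullet> x + g \<bullet> y) / (2 * D)" "c * (g \<bullet> q) = (g \<bullet> x - g \<bullet> y) / (2 * D)"
      unfolding a_def c_def times_divide_eq_left by simp_all
    then show "g \<bullet> x / D = a * (g \<bullet> p) + c * (g \<bullet> q)" "g \<bullet> y / D = a * (g \<bullet> p) - c * (g \<bullet> q)"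
      by (simp_all add: add_divide_distrib diff_divide_distrib)
  qed
  define k where "k w = ennreal (relu (fst w + snd w) * relu (fst w - snd w))" for w :: "real \<times> real"
  have [measurable]: "k \<in> borel_measurable (borel \<Otimes>\<^sub>M borel)"
    unfolding k_def by measurable
  \<comment> \<open>The integrand is nonnegative, so the Bochner integral can be read off from the
    nonnegative one without proving integrability.\<close>
  have "cov_expectation relu \<sigma> x y =
      enn2real (\<integral>\<^sup>+z. k (a * (fst z \<bullet> p) + snd z, c * (fst z \<bullet> q)) \<partial>(std_gaussian_vec \<Otimes>\<^sub>M centered_gaussian \<sigma>))"
    unfolding cov_expectation_def D_def[symmetric]
    by (subst integral_eq_nn_integral)
      (auto simp: k_def split algebra_simps case_prod_unfold intro!: arg_cong[where f=enn2real] nn_integral_cong)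
  also have "\<dots> = enn2real (\<integral>\<^sup>+u. \<integral>\<^sup>+v. k (u, v) \<partial>centered_gaussian \<beta> \<partial>centered_gaussian \<alpha>)"
    using nn_integral_std_gaussian_vec_shift[OF p(1) q(1,2) nn \<sigma>, of k] by (simp add: \<alpha> \<beta>)
  finally have cov: "cov_expectation relu \<sigma> x y =
    enn2real (\<integral>\<^sup>+u. \<integral>\<^sup>+v. ennreal (relu (u + v) * relu (u - v)) \<partial>centered_gaussian \<beta> \<partial>centered_gaussian \<alpha>)"
    by (simp add: k_def)
  have "0 < \<alpha>"
    using t by (simp add: \<alpha>_def add_pos_nonneg)
  show ?thesis
  proof (cases "x = y")
    case True
    then have "\<beta> = 0" using x by (simp add: \<beta>_def norm_eq_1)
    then show ?thesis
      using cov True nn_integral_relu_square_gaussian[OF \<open>0 < \<alpha>\<close>]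
      by (simp add: centered_gaussian_def[of 0] nn_integral_return)
  next
    case False
    then have "0 < \<beta>" using D by (simp flip: \<beta> add: c_def)
    \<comment> \<open>This makes the closed form nonnegative, so that \<open>enn2real\<close>
      returns it unchanged.\<close>
    have "\<beta> \<le> \<alpha>"
      unfolding \<alpha>_def \<beta>_def real_sqrt_le_iff using t
      by (intro add_increasing2 divide_right_mono) auto
    then have "0 \<le> ((\<alpha>\<^sup>2 - \<beta>\<^sup>2) * arctan (\<alpha> / \<beta>) + \<alpha> * \<beta>) / pi"
      using \<open>0 < \<alpha>\<close> \<open>0 < \<beta>\<close> by (intro divide_nonneg_pos add_nonneg_nonneg mult_nonneg_nonneg) (auto intro: power_mono)
    then show ?thesis
      using cov False nn_integral_relu_gaussian[OF \<open>0 < \<alpha>\<close> \<open>0 < \<beta>\<close>] by simp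
  qed
qed

section \<open>From covariances to values of \<open>kappa\<close>\<close>

text \<open>The witness pair makes the definite description nonvacuous: without a pair of inner
  product \<open>t\<close>, every \<open>k\<close> would satisfy it.\<close>

lemma kappa_eqI:
  fixes x y :: "real ^ 'n::finite"
  assumes "norm x = 1" "norm y = 1" "x \<bullet> y = t"
    and "\<And>x y :: real ^ 'n. norm x = 1 \<Longrightarrow> norm y = 1 \<Longrightarrow> x \<bullet> y = t \<Longrightarrow> cov_expectation \<phi> \<sigma>\<^sub>U x y = c"
  shows "kappa TYPE('n) \<phi> \<sigma>\<^sub>U \<sigma>\<^sub>W t = c + \<sigma>\<^sub>W\<^sup>2"
  unfolding kappa_def using assms by (intro the_equality) auto

lemma unit_vectors_with_inner:
  assumes "2 \<le> CARD('n::finite)" "-1 \<le> t" "t \<le> 1"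
  obtains x y :: "real ^ 'n" where "norm x = 1" "norm y = 1" "x \<bullet> y = t"
proof -
  obtain x :: "real ^ 'n" where x: "norm x = 1"
    using vector_choose_size[of 1] by auto
  obtain z where "z \<noteq> 0" "orthogonal x z"
    using orthogonal_to_vector_exists[of x] assms(1) by auto
  then obtain e where e: "norm e = 1" "x \<bullet> e = 0"
    by (metis orthogonal_clauses(2) orthogonal_def norm_sgn sgn_div_norm)
  \<comment> \<open>The unit vector at angle arccos \<open>t\<close> from \<open>x\<close> in the
    plane of \<open>x\<close> and \<open>e\<close>.\<close>
  define y where "y = t *\<^sub>R x + sqrt (1 - t\<^sup>2) *\<^sub>R e"
  have "x \<bullet> x = 1" "e \<bullet> e = 1" "e \<bullet> x = 0"
    using x e by (simp_all add: norm_eq_1 inner_commute)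
  moreover have "t\<^sup>2 \<le> 1" using assms by (simp add: abs_square_le_1)
  ultimately have "norm y = 1" "x \<bullet> y = t"
    using e by (simp_all add: y_def norm_eq_1 inner_add power2_eq_square[symmetric])
  then show ?thesis using that x by blast
qed

lemma kappa_relu_1:
  assumes card: "2 \<le> CARD('n::finite)" and \<sigma>: "0 \<le> \<sigma>\<^sub>U"
  shows "kappa TYPE('n) relu \<sigma>\<^sub>U \<sigma>\<^sub>W 1 = (1 / real CARD('n) + \<sigma>\<^sub>U\<^sup>2) / 2 + \<sigma>\<^sub>W\<^sup>2"
proof -
  obtain x y :: "real ^ 'n" where xy: "norm x = 1" "norm y = 1" "x \<bullet> y = 1"
    using unit_vectors_with_inner[OF card, of 1] by auto
  show ?thesis
  proof (rule kappa_eqI[OF xy])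
    fix x y :: "real ^ 'n"
    assume xy: "norm x = 1" "norm y = 1" "x \<bullet> y = 1"
    \<comment> \<open>The squared norm of \<open>x - y\<close> is 1 - 2 + 1 = 0.\<close>
    then have "x = y"
      using norm_eq_1[of x] norm_eq_1[of y] inner_eq_zero_iff[of "x - y"]
      by (simp add: inner_diff inner_commute)
    then show "cov_expectation relu \<sigma>\<^sub>U x y = (1 / real CARD('n) + \<sigma>\<^sub>U\<^sup>2) / 2"
      using cov_expectation_relu[OF card xy(1,2) _ \<sigma>] xy(3) by simp
  qed
qed

lemma kappa_relu:
  fixes t \<sigma>\<^sub>U \<sigma>\<^sub>W :: real
  defines "\<alpha> \<equiv> sqrt ((1 + t) / (2 * real CARD('n)) + \<sigma>\<^sub>U\<^sup>2)"
    and "\<beta> \<equiv> sqrt ((1 - t) / (2 * real CARD('n)))"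
  assumes card: "2 \<le> CARD('n::finite)" and \<sigma>: "0 \<le> \<sigma>\<^sub>U" and t: "0 \<le> t" "t < 1"
  shows "kappa TYPE('n) relu \<sigma>\<^sub>U \<sigma>\<^sub>W t = ((t / real CARD('n) + \<sigma>\<^sub>U\<^sup>2) * arctan (\<alpha> / \<beta>) + \<alpha> * \<beta>) / pi + \<sigma>\<^sub>W\<^sup>2"
proof -
  obtain x y :: "real ^ 'n" where xy: "norm x = 1" "norm y = 1" "x \<bullet> y = t"
    using unit_vectors_with_inner[OF card, of t] t by auto
  \<comment> \<open>The difference of the two variances is the covariance of the
    preactivations.\<close>
  have diff: "\<alpha>\<^sup>2 - \<beta>\<^sup>2 = t / real CARD('n) + \<sigma>\<^sub>U\<^sup>2"
  proof -
    have "\<alpha>\<^sup>2 = (1 + t) / (2 * real CARD('n)) + \<sigma>\<^sub>U\<^sup>2" "\<beta>\<^sup>2 = (1 - t) / (2 * real CARD('n))"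
      unfolding \<alpha>_def \<beta>_def by (rule real_sqrt_pow2, use t in simp)+
    then show ?thesis
      by (simp add: field_simps)
  qed
  show ?thesis
  proof (rule kappa_eqI[OF xy])
    fix x y :: "real ^ 'n"
    assume xy: "norm x = 1" "norm y = 1" "x \<bullet> y = t"
    then have "x \<noteq> y"
      using t by (auto simp: norm_eq_1)
    then show "cov_expectation relu \<sigma>\<^sub>U x y =
        ((t / real CARD('n) + \<sigma>\<^sub>U\<^sup>2) * arctan (\<alpha> / \<beta>) + \<alpha> * \<beta>) / pi"
      using cov_expectation_relu[OF card xy(1,2) _ \<sigma>] xy(3) t
      unfolding diff[symmetric] \<alpha>_def \<beta>_def by simp
  qed
qed

section \<open>The derivative of \<open>kappa\<close> at 1 and the final formulas\<close>

text \<open>A left limit at 1 needs the derivative only on the open interval from 0 to 1, where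
  \<open>kappa\<close> agrees with its closed form.\<close>

lemma kappa_deriv_1_relu:
  assumes card: "2 \<le> CARD('n::finite)" and \<sigma>: "0 \<le> \<sigma>\<^sub>U"
  shows "kappa_deriv_1 TYPE('n) relu \<sigma>\<^sub>U \<sigma>\<^sub>W = 1 / (2 * real CARD('n))"
proof -
  define d where "d = real CARD('n)"
  have d: "0 < d" by (simp add: d_def)
  define A where "A t = (1 + t) / (2 * d) + \<sigma>\<^sub>U\<^sup>2" for t
  define B where "B t = (1 - t) / (2 * d)" for t
  define Q where "Q t = sqrt (A t) / sqrt (B t)" for t
  have pos: "0 < A t" "0 < B t" if "t \<in> {0<..<1}" for t
    using that d by (auto simp: A_def B_def intro!: add_pos_nonneg)
  have deriv: "deriv (kappa TYPE('n) relu \<sigma>\<^sub>U \<sigma>\<^sub>W) t = arctan (Q t) / (pi * d)" if t: "t \<in> {0<..<1}" for t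
  proof (rule DERIV_imp_deriv, rule has_field_derivative_transform_within_open)
    define a where "a = sqrt (A t)"
    define b where "b = sqrt (B t)"
    have ab: "0 < a" "0 < b" "a\<^sup>2 = A t" "b\<^sup>2 = B t" and aA: "sqrt (A t) = a" and bB: "sqrt (B t) = b"
      using pos[OF t] by (simp_all add: a_def b_def)
    have m: "t / d + \<sigma>\<^sub>U\<^sup>2 = a\<^sup>2 - b\<^sup>2"
      using d by (simp add: ab A_def B_def field_simps)
    have dA: "((\<lambda>t. sqrt (A t)) has_real_derivative 1 / (4 * d * a)) (at t)"
    proof -
      have "(A has_real_derivative 1 / (2 * d)) (at t)"
        unfolding A_def using d by (auto intro!: derivative_eq_intros)
      from DERIV_chain2[OF DERIV_real_sqrt[OF pos(1)[OF t]] this]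
      show ?thesis by (simp add: aA field_simps)
    qed
    have dB: "((\<lambda>t. sqrt (B t)) has_real_derivative - (1 / (4 * d * b))) (at t)"
    proof -
      have "(B has_real_derivative - (1 / (2 * d))) (at t)"
        unfolding B_def using d by (auto intro!: derivative_eq_intros)
      from DERIV_chain2[OF DERIV_real_sqrt[OF pos(2)[OF t]] this]
      show ?thesis by (simp add: bB field_simps)
    qed
    have dQ: "(Q has_real_derivative (a\<^sup>2 + b\<^sup>2) / (4 * d * a * b ^ 3)) (at t)"
    proof -
      have "(Q has_real_derivative (1 / (4 * d * a) * sqrt (B t) - sqrt (A t) * - (1 / (4 * d * b))) / (sqrt (B t) * sqrt (B t))) (at t)"
        unfolding Q_def using ab by (intro DERIV_divide dA dB) (simp add: bB)
      also have "(1 / (4 * d * a) * sqrt (B t) - sqrt (A t) * - (1 / (4 * d * b))) / (sqrt (B t) * sqrt (B t)) =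
          (a\<^sup>2 + b\<^sup>2) / (4 * d * a * b ^ 3)"
        using ab(1,2) d unfolding aA bB by (simp add: field_simps power2_eq_square power3_eq_cube)
      finally show ?thesis .
    qed
    have datan: "((\<lambda>t. arctan (Q t)) has_real_derivative 1 / (4 * d * a * b)) (at t)"
    proof -
      \<comment> \<open>The numerator here cancels the one in the derivative of \<open>Q\<close>,
        which leaves a simple derivative of the arctan term.\<close>
      have sq: "1 + (Q t)\<^sup>2 = (a\<^sup>2 + b\<^sup>2) / b\<^sup>2"
        using ab(1,2) by (simp add: Q_def aA bB power_divide field_simps)
      have "a\<^sup>2 + b\<^sup>2 \<noteq> 0"
        using ab(1,2) by (simp add: sum_power2_eq_zero_iff)
      then have "inverse (1 + (Q t)\<^sup>2) * ((a\<^sup>2 + b\<^sup>2) / (4 * d * a * b ^ 3)) = 1 / (4 * d * a * b)"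
        using ab(1,2) d unfolding sq by (simp add: divide_simps power2_eq_square power3_eq_cube)
      then show ?thesis
        using DERIV_chain2[OF DERIV_arctan dQ] by simp
    qed
    let ?K = "\<lambda>t. ((t / d + \<sigma>\<^sub>U\<^sup>2) * arctan (Q t) + sqrt (A t) * sqrt (B t)) / pi + \<sigma>\<^sub>W\<^sup>2"
    have dlin: "((\<lambda>t. t / d + \<sigma>\<^sub>U\<^sup>2) has_real_derivative 1 / d) (at t)"
      using d by (auto intro!: derivative_eq_intros)
    have "(?K has_real_derivative
        ((1 / d) * arctan (Q t) + 1 / (4 * d * a * b) * (t / d + \<sigma>\<^sub>U\<^sup>2) +
         (1 / (4 * d * a) * sqrt (B t) + - (1 / (4 * d * b)) * sqrt (A t))) / pi + 0) (at t)"
      by (intro DERIV_add DERIV_const DERIV_cdivide DERIV_mult dlin datan dA dB)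
    also have "((1 / d) * arctan (Q t) + 1 / (4 * d * a * b) * (t / d + \<sigma>\<^sub>U\<^sup>2) +
         (1 / (4 * d * a) * sqrt (B t) + - (1 / (4 * d * b)) * sqrt (A t))) / pi + 0 = arctan (Q t) / (pi * d)"
      \<comment> \<open>By \<open>m\<close>, the second summand is
        \<open>a / (4 * d * b) - b / (4 * d * a)\<close>, the negative of what the product of square
        roots contributes.\<close>
      unfolding m aA bB using ab(1,2) d by (simp add: field_simps power2_eq_square)
    finally show "(?K has_real_derivative arctan (Q t) / (pi * d)) (at t)" .
    show "?K s = kappa TYPE('n) relu \<sigma>\<^sub>U \<sigma>\<^sub>W s" if "s \<in> {0<..<1}" for s
      using kappa_relu[OF card \<sigma>, of s \<sigma>\<^sub>W] that by (simp add: A_def B_def Q_def d_def)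
  qed (use t in auto)
  \<comment> \<open>The denominator tends to 0 through positive values while the numerator has a
    positive limit, so the arctan tends to pi / 2.\<close>
  have "filterlim Q at_top (at_left 1)"
    unfolding Q_def
  proof (rule LIM_at_top_divide)
    show "((\<lambda>t. sqrt (A t)) \<longlongrightarrow> sqrt (A 1)) (at_left 1)" "((\<lambda>t. sqrt (B t)) \<longlongrightarrow> 0) (at_left 1)"
      unfolding A_def B_def using d by (auto intro!: tendsto_eq_intros)
    show "0 < sqrt (A 1)"
      using d by (simp add: A_def add_pos_nonneg)
    show "\<forall>\<^sub>F t in at_left 1. 0 < sqrt (B t)"
      using eventually_at_left_real[of 0 1] by (rule eventually_mono) (auto simp: pos)
  qed
  then have "((\<lambda>t. arctan (Q t) / (pi * d)) \<longlongrightarrow> (pi / 2) / (pi * d)) (at_left 1)"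
    using d by (intro tendsto_divide tendsto_const filterlim_compose[OF tendsto_arctan_at_top]) auto
  moreover have "\<forall>\<^sub>F t in at_left 1. arctan (Q t) / (pi * d) = deriv (kappa TYPE('n) relu \<sigma>\<^sub>U \<sigma>\<^sub>W) t"
    using eventually_at_left_real[of 0 1] by (rule eventually_mono) (auto simp: deriv)
  ultimately have "(deriv (kappa TYPE('n) relu \<sigma>\<^sub>U \<sigma>\<^sub>W) \<longlongrightarrow> (pi / 2) / (pi * d)) (at_left 1)"
    by (rule Lim_transform_eventually)
  then have "Lim (at_left 1) (deriv (kappa TYPE('n) relu \<sigma>\<^sub>U \<sigma>\<^sub>W)) = (pi / 2) / (pi * d)"
    by (intro tendsto_Lim) auto
  then show ?thesis
    by (simp add: kappa_deriv_1_def d_def)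
qed

theorem proposition1p5:
  fixes \<sigma>\<^sub>U \<sigma>\<^sub>W d :: real
  assumes "CARD('n::finite) \<ge> 2"
    and "d = real CARD('n)"
    and "\<sigma>\<^sub>U \<ge> 0" and "\<sigma>\<^sub>W \<ge> 0"
  shows "lambda_1 TYPE('n) relu \<sigma>\<^sub>U \<sigma>\<^sub>W
           = - (1 / (2 * d)) - (\<sigma>\<^sub>U\<^sup>2 + 2 * \<sigma>\<^sub>W\<^sup>2) * (d - 1) / 4
    \<and> lambda_1 TYPE('n) relu \<sigma>\<^sub>U \<sigma>\<^sub>W < 0
    \<and> lambda_bar TYPE('n) relu \<sigma>\<^sub>U \<sigma>\<^sub>W
           = 1 / d - (\<sigma>\<^sub>U\<^sup>2 + 2 * \<sigma>\<^sub>W\<^sup>2) * (d - 3) / 2"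
proof -
  have d: "2 \<le> d" using assms by simp
  have D: "kappa_deriv_1 TYPE('n) relu \<sigma>\<^sub>U \<sigma>\<^sub>W = 1 / (2 * d)"
    using kappa_deriv_1_relu[OF assms(1,3)] assms(2) by simp
  have K: "kappa TYPE('n) relu \<sigma>\<^sub>U \<sigma>\<^sub>W 1 = (1 / d + \<sigma>\<^sub>U\<^sup>2) / 2 + \<sigma>\<^sub>W\<^sup>2"
    using kappa_relu_1[OF assms(1,3)] assms(2) by simp
  have l1: "lambda_1 TYPE('n) relu \<sigma>\<^sub>U \<sigma>\<^sub>W = - (1 / (2 * d)) - (\<sigma>\<^sub>U\<^sup>2 + 2 * \<sigma>\<^sub>W\<^sup>2) * (d - 1) / 4"
    using d unfolding lambda_1_def D K assms(2)[symmetric] by (simp add: field_simps)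
  \<comment> \<open>Strict negativity comes from the first summand alone, so it survives vanishing
    bias variances.\<close>
  moreover have "0 < 1 / (2 * d)" "0 \<le> (\<sigma>\<^sub>U\<^sup>2 + 2 * \<sigma>\<^sub>W\<^sup>2) * (d - 1) / 4"
    using d by simp_all
  moreover have "lambda_bar TYPE('n) relu \<sigma>\<^sub>U \<sigma>\<^sub>W = 1 / d - (\<sigma>\<^sub>U\<^sup>2 + 2 * \<sigma>\<^sub>W\<^sup>2) * (d - 3) / 2"
    using d unfolding lambda_bar_def D K assms(2)[symmetric] by (simp add: field_simps)
  ultimately show ?thesis by linarith
qed

end
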